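(* Let $u\in\mathcal{S}^{d-1}$ be fixed, let $X_1,\dots,X_n$ be i.i.d. from $\mathrm{GMM}(\pi,\mu^*,I_d)$, and let $$g(X)=\sup_{\mu\in\mathbb{A}}\left(\frac1n\sum_{j=1}^n w_1(X_j;\mu)\langle X_j-\mu_1,u\rangle-\mathbb{E}_X\, w_1(X;\mu)\langle X-\mu_1,u\rangle\right).$$ Then $$P\left(g(X)-\mathbb{E}g(X)>2(1+3R_{\max})\sqrt{\frac{d\log n}{n}}\right)\le n^{-d}.$$
   Context: Fix integers $M\ge 2$, $d\ge1$; weights $\pi_i>0$, $\sum_i\pi_i=1$; centers $\mu_i^*\in\mathbb{R}^d$ with $\sum_i\pi_i\mu_i^*=0$; $\mathrm{GMM}(\pi,\mu^*,I_d)$ has density $\sum_i\pi_i\phi(x\mid\mu_i^*,I_d)$; in the inner expectation $X\sim\mathrm{GMM}(\pi,\mu^*,I_d)$. For stacked $\mu\in\mathbb{R}^{Md}$, $w_1(x;\mu)=\frac{\pi_1\phi(x\mid\mu_1,I_d)}{\sum_j\pi_j\phi(x\mid\mu_j,I_d)}$. $R_{\max}=\max_{i\ne j}\|\mu_i^*-\mu_j^*\|$, $R_{\min}=\min_{i\ne j}\|\mu_i^*-\mu_j^*\|$, $\kappa=\max\pi_i/\min\pi_i$, $d_0=\min\{d,M\}$. The region is $\mathbb{A}=\prod_{i=1}^M\mathbb{B}(\mu_i^*,a)$ where $R_{\min}=\tilde\Omega(\sqrt{d_0})$ and $a\le\frac{R_{\min}}2-\sqrt{d_0}\,O(\sqrt{\log\max\{M^2\kappa/\pi_{\min},R_{\max},d_0\}})$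 ($O$ hides universal constants, $\tilde\Omega$ ignores logarithmic factors). *)

theory Defs
  imports "HOL-Probability.Probability"
begin

text \<open>Vectors of R^d are represented as functions nat => real that are
extensional on {..<d}, i.e. elements of space (Rd d).  This lets the
dimension d be quantified inside the statement (needed since the hidden
constants are universal).  Mixture components are indexed by {1..M}.\<close>

definition Rd :: "nat \<Rightarrow> (nat \<Rightarrow> real) measure" where
  "Rd d = PiM {..<d} (\<lambda>_. lborel)"

definition inner_d :: "nat \<Rightarrow> (nat \<Rightarrow> real) \<Rightarrow> (nat \<Rightarrow> real) \<Rightarrow> real" where
  "inner_d d x y = (\<Sum>k<d. x k * y k)"

definition norm_d :: "nat \<Rightarrow> (nat \<Rightarrow> real) \<Rightarrow> real" where
  "norm_d d x = sqrt (inner_d d x x)"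

definition vdiff :: "(nat \<Rightarrow> real) \<Rightarrow> (nat \<Rightarrow> real) \<Rightarrow> (nat \<Rightarrow> real)" where
  "vdiff x y = (\<lambda>k. x k - y k)"

definition gauss_pdf :: "nat \<Rightarrow> (nat \<Rightarrow> real) \<Rightarrow> (nat \<Rightarrow> real) \<Rightarrow> real" where
  "gauss_pdf d m x = (2 * pi) powr (- real d / 2) * exp (- (norm_d d (vdiff x m))\<^sup>2 / 2)"

definition gmm_pdf :: "nat \<Rightarrow> nat \<Rightarrow> (nat \<Rightarrow> real) \<Rightarrow> (nat \<Rightarrow> nat \<Rightarrow> real)
    \<Rightarrow> (nat \<Rightarrow> real) \<Rightarrow> real" where
  "gmm_pdf d M p m x = (\<Sum>i\<in>{1..M}. p i * gauss_pdf d (m i) x)"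

definition GMM :: "nat \<Rightarrow> nat \<Rightarrow> (nat \<Rightarrow> real) \<Rightarrow> (nat \<Rightarrow> nat \<Rightarrow> real)
    \<Rightarrow> (nat \<Rightarrow> real) measure" where
  "GMM d M p m = density (Rd d) (\<lambda>x. ennreal (gmm_pdf d M p m x))"

definition w1 :: "nat \<Rightarrow> nat \<Rightarrow> (nat \<Rightarrow> real) \<Rightarrow> (nat \<Rightarrow> nat \<Rightarrow> real)
    \<Rightarrow> (nat \<Rightarrow> real) \<Rightarrow> real" where
  "w1 d M p mu x = p 1 * gauss_pdf d (mu 1) x / gmm_pdf d M p mu x"

definition Rmax :: "nat \<Rightarrow> nat \<Rightarrow> (nat \<Rightarrow> nat \<Rightarrow> real) \<Rightarrow> real" where
  "Rmax d M m = Max {norm_d d (vdiff (m i) (m j)) | i j. i \<in> {1..M} \<and> j \<in> {1..M} \<and> i \<noteq> j}"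

definition Rmin :: "nat \<Rightarrow> nat \<Rightarrow> (nat \<Rightarrow> nat \<Rightarrow> real) \<Rightarrow> real" where
  "Rmin d M m = Min {norm_d d (vdiff (m i) (m j)) | i j. i \<in> {1..M} \<and> j \<in> {1..M} \<and> i \<noteq> j}"

definition pi_min :: "nat \<Rightarrow> (nat \<Rightarrow> real) \<Rightarrow> real" where
  "pi_min M p = Min (p ` {1..M})"

definition kappa :: "nat \<Rightarrow> (nat \<Rightarrow> real) \<Rightarrow> real" where
  "kappa M p = Max (p ` {1..M}) / Min (p ` {1..M})"

definition regionA :: "nat \<Rightarrow> nat \<Rightarrow> (nat \<Rightarrow> nat \<Rightarrow> real) \<Rightarrow> real
    \<Rightarrow> (nat \<Rightarrow> nat \<Rightarrow> real) set" where
  "regionA d M m a = PiE {1..M} (\<lambda>i. {v \<in> space (Rd d). norm_d d (vdiff v (m i)) \<le> a})"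

definition gsup :: "nat \<Rightarrow> nat \<Rightarrow> (nat \<Rightarrow> real) \<Rightarrow> (nat \<Rightarrow> nat \<Rightarrow> real) \<Rightarrow> real
    \<Rightarrow> (nat \<Rightarrow> real) \<Rightarrow> nat \<Rightarrow> (nat \<Rightarrow> nat \<Rightarrow> real) \<Rightarrow> real" where
  "gsup d M p m a u n Xs =
     (SUP mu \<in> regionA d M m a.
        (1 / real n) * (\<Sum>j<n. w1 d M p mu (Xs j) * inner_d d (vdiff (Xs j) (mu 1)) u)
        - (\<integral>x. w1 d M p mu x * inner_d d (vdiff x (mu 1)) u \<partial>GMM d M p m))"

definition sample :: "nat \<Rightarrow> nat \<Rightarrow> (nat \<Rightarrow> real) \<Rightarrow> (nat \<Rightarrow> nat \<Rightarrow> real) \<Rightarrow> nat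
    \<Rightarrow> (nat \<Rightarrow> nat \<Rightarrow> real) measure" where
  "sample d M p m n = PiM {..<n} (\<lambda>_. GMM d M p m)"

end

theory Submission
  imports Defs
begin

text \<open>
  Write \<open>h x = \<bar>\<langle>x - \<mu>\<^sub>1\<^sup>*, u\<rangle>\<bar> + a\<close>. Since \<open>0 \<le> w\<^sub>1 \<le> 1\<close>, replacing one sample
  point \<open>x\<close> by \<open>y\<close> changes \<open>g\<close> by at most \<open>(h x + h y) / n\<close>, uniformly over the region. This is
  unbounded, but under the \<open>i\<close>-th mixture component \<open>h x \<le> \<bar>\<xi>\<bar> + 3 R\<^sub>m\<^sub>a\<^sub>x / 2\<close> with a standard
  Gaussian \<open>\<xi>\<close>. By symmetrisation, a one-coordinate fluctuation \<open>\<phi>\<close> satisfies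
  \<open>E exp (\<lambda>(\<phi> - E \<phi>)) \<le> E cosh (\<lambda>(h x + h y) / n) \<le> exp ((1 + 3 R\<^sub>m\<^sub>a\<^sub>x)\<^sup>2 \<lambda>\<^sup>2 / n\<^sup>2)\<close>, the last step
  because the separation assumption forces \<open>R\<^sub>m\<^sub>a\<^sub>x\<close> to be at least a constant. Integrating out the
  coordinates one at a time as in McDiarmid's inequality and applying Chernoff's bound gives the
  claim.
\<close>

subsection \<open>Concentration under unbounded differences\<close>

text \<open>Symmetrisation with an independent copy \<open>y\<close> of \<open>x\<close>: the
  integral of \<open>exp (\<phi> x - \<phi> y)\<close> over both is unchanged when averaged with its
  mirror image, which turns it into an integral of \<open>cosh (\<phi> x - \<phi> y)\<close>. The
  product form \<open>k x * k y\<close> of the majorant separates the variables, so iterated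
  integrals give the square of the integral of \<open>k\<close>, hence at most \<open>exp V\<close>.
  Jensen's inequality then removes the copy.\<close>

lemma exp_moment_of_bounded_oscillation:
  fixes N :: "'a measure" and \<phi> H k :: "'a \<Rightarrow> real" and V :: real
  assumes "prob_space N"
    and [measurable]: "H \<in> borel_measurable N" "\<phi> \<in> borel_measurable N"
    and H0: "\<And>x. x \<in> space N \<Longrightarrow> 0 \<le> H x"
    and k: "integrable N k" "(\<integral>x. k x \<partial>N) \<le> exp (V / 2)"
    and k0: "\<And>x. 0 \<le> k x"
    and Hk: "\<And>x y. x \<in> space N \<Longrightarrow> y \<in> space N \<Longrightarrow> cosh (H x + H y) \<le> k x * k y"
    and osc: "\<And>x y. x \<in> space N \<Longrightarrow> y \<in> space N \<Longrightarrow> \<bar>\<phi> x - \<phi> y\<bar> \<le> H x + H y"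
  shows "integrable N H" "integrable N \<phi>"
    and "x \<in> space N \<Longrightarrow> \<bar>\<phi> x - (\<integral>y. \<phi> y \<partial>N)\<bar> \<le> H x + (\<integral>y. H y \<partial>N)"
    and "(\<integral>\<^sup>+x. ennreal (exp (\<phi> x - (\<integral>y. \<phi> y \<partial>N))) \<partial>N) \<le> ennreal (exp V)"
proof -
  interpret prob_space N by fact
  obtain x0 where x0: "x0 \<in> space N" using not_empty by blast
  \<comment> \<open>Freezing one argument of the majorant at a fixed point \<open>x0\<close> gives
    an exponential moment of \<open>H\<close>; all other integrability claims follow from it by
    domination.\<close>
  have exp_H: "exp (H x) \<le> 2 * k x0 * k x" if "x \<in> space N" for x
  proof -
    have "exp (H x) \<le> exp (H x + H x0)" using H0[OF x0] by simp
    also have "\<dots> \<le> 2 * cosh (H x + H x0)" by (simp add: cosh_def)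
    also have "\<dots> \<le> 2 * k x0 * k x" using Hk[OF that x0] by (simp add: mult.commute)
    finally show ?thesis .
  qed
  have int_exp_H: "integrable N (\<lambda>x. exp (H x))"
  proof (rule Bochner_Integration.integrable_bound)
    show "integrable N (\<lambda>x. 2 * k x0 * k x)" using k(1) by simp
    show "AE x in N. norm (exp (H x)) \<le> norm (2 * k x0 * k x)"
      using exp_H k0 by (intro AE_I2) (simp add: abs_mult)
  qed simp
  show int_H: "integrable N H"
  proof (rule Bochner_Integration.integrable_bound[OF int_exp_H])
    show "AE x in N. norm (H x) \<le> norm (exp (H x))"
    proof (intro AE_I2)
      fix x assume "x \<in> space N"
      then show "norm (H x) \<le> norm (exp (H x))"
        using H0[of x] exp_ge_add_one_self[of "H x"] unfolding real_norm_def by linarith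
    qed
  qed simp
  show int_\<phi>: "integrable N \<phi>"
  proof (rule Bochner_Integration.integrable_bound)
    show "integrable N (\<lambda>x. \<bar>\<phi> x0\<bar> + H x0 + H x)" using int_H by simp
    show "AE x in N. norm (\<phi> x) \<le> norm (\<bar>\<phi> x0\<bar> + H x0 + H x)"
    proof (intro AE_I2)
      fix x assume "x \<in> space N"
      then show "norm (\<phi> x) \<le> norm (\<bar>\<phi> x0\<bar> + H x0 + H x)"
        using osc[of x x0] x0 H0[of x] H0[of x0] by simp
    qed
  qed simp
  define e where "e = (\<integral>y. \<phi> y \<partial>N)"
  show "\<bar>\<phi> x - (\<integral>y. \<phi> y \<partial>N)\<bar> \<le> H x + (\<integral>y. H y \<partial>N)" if x: "x \<in> space N" for x
  proof -
    have "\<phi> x - (\<integral>y. \<phi> y \<partial>N) = (\<integral>y. \<phi> x - \<phi> y \<partial>N)"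
      using int_\<phi> by (simp add: prob_space)
    also have "\<bar>\<dots>\<bar> \<le> (\<integral>y. \<bar>\<phi> x - \<phi> y\<bar> \<partial>N)" by (rule integral_abs_bound)
    also have "\<dots> \<le> (\<integral>y. H x + H y \<partial>N)"
      using int_\<phi> int_H osc[OF x] by (intro integral_mono) auto
    also have "\<dots> = H x + (\<integral>y. H y \<partial>N)"
      using int_H by (simp add: prob_space)
    finally show ?thesis .
  qed
  have int_exp: "integrable N (\<lambda>x. exp (s * \<phi> x))" if "\<bar>s\<bar> = 1" for s
  proof (rule Bochner_Integration.integrable_bound)
    show "integrable N (\<lambda>x. exp (\<bar>\<phi> x0\<bar> + H x0) * exp (H x))" using int_exp_H by simp
    show "AE x in N. norm (exp (s * \<phi> x)) \<le> norm (exp (\<bar>\<phi> x0\<bar> + H x0) * exp (H x))"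
    proof (intro AE_I2)
      fix x assume "x \<in> space N"
      then have "s * \<phi> x \<le> \<bar>\<phi> x0\<bar> + H x0 + H x"
        using osc[of x x0] x0 H0[of x] H0[of x0] that by (auto simp: abs_if split: if_splits)
      then show "norm (exp (s * \<phi> x)) \<le> norm (exp (\<bar>\<phi> x0\<bar> + H x0) * exp (H x))"
        by (simp flip: exp_add)
    qed
  qed simp
  have ip: "integrable N (\<lambda>x. exp (\<phi> x))" and im: "integrable N (\<lambda>x. exp (- \<phi> x))"
    using int_exp[of 1] int_exp[of "-1"] by simp_all
  define A where "A = (\<integral>x. exp (\<phi> x) \<partial>N)"
  define B where "B = (\<integral>x. exp (- \<phi> x) \<partial>N)"
  define K where "K = (\<integral>x. k x \<partial>N)"
  have K0: "0 \<le> K" unfolding K_def using k0 by (intro integral_nonneg_AE) simp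
  have A0: "0 \<le> A" unfolding A_def by simp
  \<comment> \<open>The copy \<open>y\<close> is integrated out first, for fixed \<open>x\<close>.
    Since \<open>cosh\<close> is even and increasing on the nonnegative reals, only the size of the
    oscillation matters.\<close>
  have inner: "(exp (\<phi> x) * B + exp (- \<phi> x) * A) / 2 \<le> k x * K" if x: "x \<in> space N" for x
  proof -
    have "(exp (\<phi> x) * B + exp (- \<phi> x) * A) / 2
        = (\<integral>y. (exp (\<phi> x) * exp (- \<phi> y) + exp (- \<phi> x) * exp (\<phi> y)) / 2 \<partial>N)"
      using ip im by (simp add: A_def B_def)
    also have "\<dots> \<le> (\<integral>y. k x * k y \<partial>N)"
    proof (rule integral_mono)
      fix y assume y: "y \<in> space N"
      have "(exp (\<phi> x) * exp (- \<phi> y) + exp (- \<phi> x) * exp (\<phi> y)) / 2 = cosh (\<phi> x - \<phi> y)"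
        by (simp add: cosh_def flip: exp_add)
      also have "\<dots> = cosh \<bar>\<phi> x - \<phi> y\<bar>" by (simp only: cosh_real_abs)
      also have "\<dots> \<le> cosh (H x + H y)"
        using osc[OF x y] H0[OF x] H0[OF y]
        by (subst cosh_real_nonneg_le_iff) auto
      also have "\<dots> \<le> k x * k y" by (rule Hk[OF x y])
      finally show "(exp (\<phi> x) * exp (- \<phi> y) + exp (- \<phi> x) * exp (\<phi> y)) / 2 \<le> k x * k y" .
    qed (use ip im k in auto)
    finally show ?thesis using k by (simp add: K_def)
  qed
  have "A * B = (\<integral>x. (exp (\<phi> x) * B + exp (- \<phi> x) * A) / 2 \<partial>N)"
    using ip im by (simp add: A_def[symmetric] B_def[symmetric] mult.commute)
  also have "\<dots> \<le> (\<integral>x. k x * K \<partial>N)"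
    using ip im k(1) inner by (intro integral_mono) auto
  also have "\<dots> = K * K" using k(1) by (simp add: K_def)
  also have "\<dots> \<le> exp (V / 2) * exp (V / 2)"
    using K0 k(2) by (intro mult_mono) (auto simp: K_def)
  also have "\<dots> = exp V" by (simp flip: exp_add)
  finally have AB: "A * B \<le> exp V" .
  \<comment> \<open>Jensen's inequality by the tangent line of \<open>exp\<close> at 0: it yields
    \<open>exp (- e) \<le> B\<close>, so that \<open>A * exp (- e)\<close> is at most
    \<open>A * B\<close>.\<close>
  have "1 = (\<integral>y. 1 + (e - \<phi> y) \<partial>N)" using int_\<phi> by (simp add: e_def prob_space)
  also have "\<dots> \<le> (\<integral>y. exp e * exp (- \<phi> y) \<partial>N)"
  proof (rule integral_mono)
    fix y show "1 + (e - \<phi> y) \<le> exp e * exp (- \<phi> y)"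
      using exp_ge_add_one_self[of "e - \<phi> y"] by (simp flip: exp_add)
  qed (use int_\<phi> im in auto)
  also have "\<dots> = exp e * B" by (simp add: B_def)
  finally have "1 \<le> exp e * B" .
  then have "exp (- e) \<le> B" by (simp add: exp_minus field_simps)
  then have le: "A * exp (- e) \<le> exp V"
    using A0 AB by (meson mult_left_mono order_trans)
  have "(\<integral>\<^sup>+x. ennreal (exp (\<phi> x - e)) \<partial>N) = (\<integral>\<^sup>+x. ennreal (exp (\<phi> x) * exp (- e)) \<partial>N)"
    by (simp flip: exp_add)
  also have "\<dots> = ennreal (\<integral>x. exp (\<phi> x) * exp (- e) \<partial>N)"
    using ip by (intro nn_integral_eq_integral) auto
  also have "\<dots> = ennreal (A * exp (- e))" using ip by (simp add: A_def)
  finally show "(\<integral>\<^sup>+x. ennreal (exp (\<phi> x - (\<integral>y. \<phi> y \<partial>N))) \<partial>N) \<le> ennreal (exp V)"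
    using le by (simp add: e_def ennreal_leI)
qed

text \<open>Induction on the number of coordinates: averaging over the last one keeps the
  oscillation bound in the others and costs a factor \<open>exp V\<close>. Integrability is part of
  the conclusion because \<open>H\<close> may be unbounded and the induction step needs it for the
  averaged function.\<close>

lemma mcdiarmid_exp_moment:
  fixes N :: "'a measure" and H k :: "'a \<Rightarrow> real" and V :: real
    and G :: "(nat \<Rightarrow> 'a) \<Rightarrow> real" and n :: nat
  assumes "prob_space N"
    and [measurable]: "H \<in> borel_measurable N"
    and H0: "\<And>x. x \<in> space N \<Longrightarrow> 0 \<le> H x"
    and k: "integrable N k" "(\<integral>x. k x \<partial>N) \<le> exp (V / 2)"
    and k0: "\<And>x. 0 \<le> k x"
    and Hk: "\<And>x y. x \<in> space N \<Longrightarrow> y \<in> space N \<Longrightarrow> cosh (H x + H y) \<le> k x * k y"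
    and G: "G \<in> borel_measurable (PiM {..<n} (\<lambda>_. N))"
    and osc: "\<And>X j y. X \<in> space (PiM {..<n} (\<lambda>_. N)) \<Longrightarrow> j < n \<Longrightarrow> y \<in> space N
        \<Longrightarrow> \<bar>G X - G (X(j := y))\<bar> \<le> H (X j) + H y"
  shows "integrable (PiM {..<n} (\<lambda>_. N)) G \<and>
    (\<integral>\<^sup>+X. ennreal (exp (G X - (\<integral>Y. G Y \<partial>PiM {..<n} (\<lambda>_. N)))) \<partial>PiM {..<n} (\<lambda>_. N))
      \<le> ennreal (exp (real n * V))"
  using G osc
proof (induction n arbitrary: G)
  case 0
  \<comment> \<open>The empty product is the unit mass at the function that is
    \<open>undefined\<close> everywhere, so \<open>G\<close> equals its own mean.\<close>
  have "integrable (PiM {} (\<lambda>_. N)) G"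
    by (simp add: PiM_empty integrable_count_space)
  moreover have "(\<integral>Y. G Y \<partial>PiM {} (\<lambda>_. N)) = G (\<lambda>_. undefined)"
    by (simp add: PiM_empty lebesgue_integral_count_space_finite)
  moreover have "(\<integral>\<^sup>+X. ennreal (exp (G X - G (\<lambda>_. undefined))) \<partial>PiM {} (\<lambda>_. N)) = 1"
    by (simp add: PiM_empty nn_integral_count_space_finite)
  ultimately show ?case by simp
next
  case (Suc n)
  interpret N: prob_space N by fact
  interpret product_sigma_finite "\<lambda>_::nat. N" ..
  let ?P = "PiM {..<n} (\<lambda>_. N)"
  interpret P: prob_space ?P by (intro prob_space_PiM \<open>prob_space N\<close>)
  have ins: "{..<Suc n} = insert n {..<n}" by auto
  note [measurable] = Suc.prems(1)[unfolded ins]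
  have upd: "X(n := y) \<in> space (PiM {..<Suc n} (\<lambda>_. N))"
    if "X \<in> space ?P" "y \<in> space N" for X y
    using that unfolding ins by (auto simp: space_PiM PiE_def extensional_def)
  have meas_pair[measurable]: "(\<lambda>(X, y). G (X(n := y))) \<in> borel_measurable (?P \<Otimes>\<^sub>M N)"
    using measurable_compose[OF measurable_add_dim[of n "{..<n}" "\<lambda>_. N"] Suc.prems(1)[unfolded ins]]
    by (simp add: case_prod_unfold)
  have meas1: "(\<lambda>y. G (X(n := y))) \<in> borel_measurable N" if "X \<in> space ?P" for X
    using measurable_compose[OF measurable_Pair1'[OF that] meas_pair] by simp
  have osc1: "\<bar>G (X(n := x)) - G (X(n := y))\<bar> \<le> H x + H y"
    if "X \<in> space ?P" "x \<in> space N" "y \<in> space N" for X x y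
    using Suc.prems(2)[OF upd[OF that(1,2)] lessI that(3)] by (simp only: fun_upd_upd fun_upd_same)
  have one: "integrable N H" "integrable N (\<lambda>y. G (X(n := y)))"
    "y \<in> space N \<Longrightarrow> \<bar>G (X(n := y)) - (\<integral>y. G (X(n := y)) \<partial>N)\<bar> \<le> H y + (\<integral>y. H y \<partial>N)"
    "(\<integral>\<^sup>+x. ennreal (exp (G (X(n := x)) - (\<integral>y. G (X(n := y)) \<partial>N))) \<partial>N) \<le> ennreal (exp V)"
    if "X \<in> space ?P" for X y
    by (rule exp_moment_of_bounded_oscillation[OF \<open>prob_space N\<close> \<open>H \<in> borel_measurable N\<close>
          meas1[OF that] H0 k k0 Hk osc1[OF that]]; assumption)+
  define G1 where "G1 X = (\<integral>y. G (X(n := y)) \<partial>N)" for X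
  have [measurable]: "G1 \<in> borel_measurable ?P"
    unfolding G1_def using N.borel_measurable_lebesgue_integral[OF meas_pair] by simp
  have osc2: "\<bar>G1 X - G1 (X(j := z))\<bar> \<le> H (X j) + H z"
    if X: "X \<in> space ?P" and j: "j < n" and z: "z \<in> space N" for X j z
  proof -
    have X': "X(j := z) \<in> space ?P"
      using X z j by (auto simp: space_PiM PiE_def extensional_def)
    have "\<bar>G1 X - G1 (X(j := z))\<bar> = \<bar>\<integral>y. G (X(n := y)) - G (X(j := z, n := y)) \<partial>N\<bar>"
      using one(2)[OF X] one(2)[OF X'] by (simp add: G1_def)
    also have "\<dots> \<le> (\<integral>y. \<bar>G (X(n := y)) - G (X(j := z, n := y))\<bar> \<partial>N)"
      by (rule integral_abs_bound)
    also have "\<dots> \<le> (\<integral>y. H (X j) + H z \<partial>N)"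
    proof (rule integral_mono)
      fix y assume y: "y \<in> space N"
      show "\<bar>G (X(n := y)) - G (X(j := z, n := y))\<bar> \<le> H (X j) + H z"
        using Suc.prems(2)[OF upd[OF X y] less_SucI[OF j] z] j
        by (simp only: fun_upd_twist[OF less_imp_neq[OF j]] fun_upd_other[OF less_imp_neq[OF j]])
    qed (use one(2)[OF X] one(2)[OF X'] in auto)
    also have "\<dots> = H (X j) + H z" by (simp add: N.prob_space)
    finally show ?thesis .
  qed
  note IH = Suc.IH[OF \<open>G1 \<in> borel_measurable ?P\<close> osc2]
  have int_H: "integrable N H"
    using one(1) P.not_empty by blast
  \<comment> \<open>Tonelli for the absolute value comes first, to justify Fubini for the signed
    \<open>G\<close> afterwards. In the last coordinate \<open>G\<close> stays within
    \<open>H y\<close> plus the mean of \<open>H\<close> of its average \<open>G1 X\<close>.\<close>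
  have "(\<integral>\<^sup>+X. ennreal \<bar>G X\<bar> \<partial>PiM {..<Suc n} (\<lambda>_. N))
      = (\<integral>\<^sup>+X. (\<integral>\<^sup>+y. ennreal \<bar>G (X(n := y))\<bar> \<partial>N) \<partial>?P)"
    unfolding ins by (rule product_nn_integral_insert) auto
  also have "\<dots> \<le> (\<integral>\<^sup>+X. ennreal (\<bar>G1 X\<bar> + 2 * (\<integral>y. H y \<partial>N)) \<partial>?P)"
  proof (rule nn_integral_mono)
    fix X assume X: "X \<in> space ?P"
    have "(\<integral>\<^sup>+y. ennreal \<bar>G (X(n := y))\<bar> \<partial>N)
        \<le> (\<integral>\<^sup>+y. ennreal (\<bar>G1 X\<bar> + (\<integral>y. H y \<partial>N) + H y) \<partial>N)"
    proof (intro nn_integral_mono ennreal_leI)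
      fix y assume "y \<in> space N"
      from one(3)[OF X this] show "\<bar>G (X(n := y))\<bar> \<le> \<bar>G1 X\<bar> + (\<integral>y. H y \<partial>N) + H y"
        by (simp add: G1_def)
    qed
    also have "\<dots> = ennreal (\<integral>y. \<bar>G1 X\<bar> + (\<integral>y. H y \<partial>N) + H y \<partial>N)"
      using int_H H0
      by (intro nn_integral_eq_integral AE_I2) (auto intro!: add_nonneg_nonneg integral_nonneg_AE)
    also have "(\<integral>y. \<bar>G1 X\<bar> + (\<integral>y. H y \<partial>N) + H y \<partial>N) = \<bar>G1 X\<bar> + 2 * (\<integral>y. H y \<partial>N)"
      using int_H by (simp add: N.prob_space)
    finally show "(\<integral>\<^sup>+y. ennreal \<bar>G (X(n := y))\<bar> \<partial>N) \<le> ennreal (\<bar>G1 X\<bar> + 2 * (\<integral>y. H y \<partial>N))" .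
  qed
  also have "\<dots> = ennreal (\<integral>X. \<bar>G1 X\<bar> + 2 * (\<integral>y. H y \<partial>N) \<partial>?P)"
    using IH H0
    by (intro nn_integral_eq_integral AE_I2) (auto intro!: add_nonneg_nonneg integral_nonneg_AE)
  also have "\<dots> < \<infinity>" by simp
  finally have int_G: "integrable (PiM {..<Suc n} (\<lambda>_. N)) G"
    using Suc.prems(1) by (intro integrableI_bounded) auto
  define e where "e = (\<integral>Y. G Y \<partial>PiM {..<Suc n} (\<lambda>_. N))"
  have e: "e = (\<integral>X. G1 X \<partial>?P)"
    using int_G unfolding e_def G1_def ins by (intro product_integral_insert) auto
  \<comment> \<open>The exponent splits as \<open>(G1 X - e) + (G (X(n := y)) - G1 X)\<close>. The
    second part integrates to at most \<open>exp V\<close> uniformly in \<open>X\<close>; the first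
    is the induction hypothesis, because \<open>e\<close> is also the mean of
    \<open>G1\<close>.\<close>
  have "(\<integral>\<^sup>+X. ennreal (exp (G X - e)) \<partial>PiM {..<Suc n} (\<lambda>_. N))
      = (\<integral>\<^sup>+X. (\<integral>\<^sup>+y. ennreal (exp (G (X(n := y)) - e)) \<partial>N) \<partial>?P)"
    unfolding ins by (rule product_nn_integral_insert) auto
  also have "\<dots> \<le> (\<integral>\<^sup>+X. ennreal (exp (G1 X - e)) * ennreal (exp V) \<partial>?P)"
  proof (rule nn_integral_mono)
    fix X assume X: "X \<in> space ?P"
    note [measurable] = meas1[OF X]
    have "(\<integral>\<^sup>+y. ennreal (exp (G (X(n := y)) - e)) \<partial>N)
        = (\<integral>\<^sup>+y. ennreal (exp (G1 X - e)) * ennreal (exp (G (X(n := y)) - G1 X)) \<partial>N)"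
      by (simp flip: ennreal_mult' exp_add)
    also have "\<dots> = ennreal (exp (G1 X - e)) * (\<integral>\<^sup>+y. ennreal (exp (G (X(n := y)) - G1 X)) \<partial>N)"
      by (rule nn_integral_cmult) simp
    also have "\<dots> \<le> ennreal (exp (G1 X - e)) * ennreal (exp V)"
      using one(4)[OF X] by (intro mult_left_mono) (auto simp: G1_def)
    finally show "(\<integral>\<^sup>+y. ennreal (exp (G (X(n := y)) - e)) \<partial>N)
        \<le> ennreal (exp (G1 X - e)) * ennreal (exp V)" .
  qed
  also have "\<dots> = (\<integral>\<^sup>+X. ennreal (exp (G1 X - e)) \<partial>?P) * ennreal (exp V)"
    by (rule nn_integral_multc) simp
  also have "\<dots> \<le> ennreal (exp (real n * V)) * ennreal (exp V)"
    using IH unfolding e by (intro mult_right_mono) auto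
  also have "\<dots> = ennreal (exp (real (Suc n) * V))"
    by (simp add: algebra_simps flip: ennreal_mult' exp_add)
  finally show ?case using int_G by (simp add: e_def)
qed

text \<open>Chernoff's bound with exponential parameter 1; any other parameter is obtained by
  scaling \<open>G\<close>, \<open>H\<close> and \<open>T\<close> before the lemma is
  applied.\<close>

lemma mcdiarmid_unbounded:
  fixes N :: "'a measure" and H k :: "'a \<Rightarrow> real" and V T :: real
    and G :: "(nat \<Rightarrow> 'a) \<Rightarrow> real" and n :: nat
  assumes "prob_space N"
    and "H \<in> borel_measurable N"
    and "\<And>x. x \<in> space N \<Longrightarrow> 0 \<le> H x"
    and "integrable N k" "(\<integral>x. k x \<partial>N) \<le> exp (V / 2)"
    and "\<And>x. 0 \<le> k x"
    and "\<And>x y. x \<in> space N \<Longrightarrow> y \<in> space N \<Longrightarrow> cosh (H x + H y) \<le> k x * k y"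
    and G[measurable]: "G \<in> borel_measurable (PiM {..<n} (\<lambda>_. N))"
    and "\<And>X j y. X \<in> space (PiM {..<n} (\<lambda>_. N)) \<Longrightarrow> j < n \<Longrightarrow> y \<in> space N
        \<Longrightarrow> \<bar>G X - G (X(j := y))\<bar> \<le> H (X j) + H y"
  shows "measure (PiM {..<n} (\<lambda>_. N))
      {X \<in> space (PiM {..<n} (\<lambda>_. N)). G X - (\<integral>Y. G Y \<partial>PiM {..<n} (\<lambda>_. N)) > T}
    \<le> exp (real n * V - T)"
proof -
  let ?P = "PiM {..<n} (\<lambda>_. N)"
  interpret P: prob_space ?P by (intro prob_space_PiM \<open>prob_space N\<close>)
  define e where "e = (\<integral>Y. G Y \<partial>?P)"
  have m: "(\<integral>\<^sup>+X. ennreal (exp (G X - e)) \<partial>?P) \<le> ennreal (exp (real n * V))"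
    using mcdiarmid_exp_moment[OF assms] unfolding e_def by blast
  have "emeasure ?P {X \<in> space ?P. G X - e > T}
      = (\<integral>\<^sup>+X. indicator {X \<in> space ?P. G X - e > T} X \<partial>?P)"
    by (rule nn_integral_indicator[symmetric]) measurable
  also have "\<dots> \<le> (\<integral>\<^sup>+X. ennreal (exp (- T)) * ennreal (exp (G X - e)) \<partial>?P)"
  proof (rule nn_integral_mono)
    fix X
    have "1 \<le> exp (- T) * exp (G X - e)" if "G X - e > T" using that by (simp flip: exp_add)
    from ennreal_leI[OF this]
    show "indicator {X \<in> space ?P. G X - e > T} X \<le> ennreal (exp (- T)) * ennreal (exp (G X - e))"
      by (simp add: indicator_def ennreal_mult')
  qed
  also have "\<dots> = ennreal (exp (- T)) * (\<integral>\<^sup>+X. ennreal (exp (G X - e)) \<partial>?P)"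
    by (rule nn_integral_cmult) measurable
  also have "\<dots> \<le> ennreal (exp (- T)) * ennreal (exp (real n * V))"
    by (intro mult_left_mono m) simp
  also have "\<dots> = ennreal (exp (real n * V - T))"
    by (simp flip: ennreal_mult' exp_add)
  finally show ?thesis
    unfolding e_def P.emeasure_eq_measure by (simp add: ennreal_le_iff)
qed

subsection \<open>Gaussian moments along a direction\<close>

text \<open>Completing the square: the exponential tilt moves the mean from \<open>c\<close> to
  \<open>c + t\<close> and leaves the constant \<open>exp (t\<^sup>2 / 2)\<close>.\<close>

lemma nn_integral_exp_normal:
  "(\<integral>\<^sup>+x. ennreal (normal_density c 1 x * exp (t * (x - c))) \<partial>lborel) = ennreal (exp (t\<^sup>2 / 2))"
proof -
  have "normal_density c 1 x * exp (t * (x - c)) = exp (t\<^sup>2 / 2) * normal_density (c + t) 1 x" for x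
    unfolding normal_density_def
    by (simp flip: exp_add) (simp add: power2_eq_square field_simps)
  then have "(\<integral>\<^sup>+x. ennreal (normal_density c 1 x * exp (t * (x - c))) \<partial>lborel)
     = (\<integral>\<^sup>+x. ennreal (exp (t\<^sup>2 / 2)) * ennreal (normal_density (c + t) 1 x) \<partial>lborel)"
    by (simp add: ennreal_mult')
  also have "\<dots> = ennreal (exp (t\<^sup>2 / 2)) * (\<integral>\<^sup>+x. ennreal (normal_density (c + t) 1 x) \<partial>lborel)"
    by (rule nn_integral_cmult) simp
  also have "(\<integral>\<^sup>+x. ennreal (normal_density (c + t) 1 x) \<partial>lborel) = 1"
    by (subst nn_integral_eq_integral) auto
  finally show ?thesis by simp
qed

text \<open>The quadratic tilt only changes the variance, to \<open>1 / (1 - 2 * c)\<close>; the new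
  standard deviation is the value of the integral.\<close>

lemma nn_integral_exp_square_normal:
  assumes "c < 1 / 2"
  shows "(\<integral>\<^sup>+z. ennreal (std_normal_density z * exp (c * z\<^sup>2)) \<partial>lborel) = ennreal (1 / sqrt (1 - 2 * c))"
proof -
  define \<sigma> where "\<sigma> = 1 / sqrt (1 - 2 * c)"
  have \<sigma>: "0 < \<sigma>" "\<sigma>\<^sup>2 = 1 / (1 - 2 * c)"
    using assms by (auto simp: \<sigma>_def power_divide)
  have "std_normal_density z * exp (c * z\<^sup>2) = \<sigma> * normal_density 0 \<sigma> z" for z
  proof -
    have "- z\<^sup>2 / 2 + c * z\<^sup>2 = - z\<^sup>2 / (2 * \<sigma>\<^sup>2)"
      using assms unfolding \<sigma>(2) by (simp add: field_simps)
    moreover have "sqrt (2 * pi * \<sigma>\<^sup>2) = sqrt (2 * pi) * \<sigma>"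
      using \<sigma>(1) by (simp add: real_sqrt_mult)
    ultimately show ?thesis
      using \<sigma>(1) unfolding normal_density_def by (simp flip: exp_add)
  qed
  then have "(\<integral>\<^sup>+z. ennreal (std_normal_density z * exp (c * z\<^sup>2)) \<partial>lborel)
     = (\<integral>\<^sup>+x. ennreal \<sigma> * ennreal (normal_density 0 \<sigma> x) \<partial>lborel)"
    using \<sigma>(1) by (simp add: ennreal_mult')
  also have "\<dots> = ennreal \<sigma> * (\<integral>\<^sup>+x. ennreal (normal_density 0 \<sigma> x) \<partial>lborel)"
    by (rule nn_integral_cmult) simp
  also have "(\<integral>\<^sup>+x. ennreal (normal_density 0 \<sigma> x) \<partial>lborel) = 1"
    using \<sigma>(1) by (subst nn_integral_eq_integral) auto
  finally show ?thesis by (simp add: \<sigma>_def)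
qed

section \<open>Coordinate formulas, measurability and Gaussian integrals on R^d\<close>

lemma norm_d_power2: "(norm_d d x)\<^sup>2 = (\<Sum>k<d. (x k)\<^sup>2)"
  unfolding norm_d_def inner_d_def
  by (simp add: sum_nonneg power2_eq_square)

lemma abs_inner_d_le: "\<bar>inner_d d x y\<bar> \<le> norm_d d x * norm_d d y"
proof -
  have "(inner_d d x y)\<^sup>2 \<le> (norm_d d x * norm_d d y)\<^sup>2"
    unfolding power_mult_distrib norm_d_power2 unfolding inner_d_def
    by (rule Cauchy_Schwarz_ineq_sum)
  then show ?thesis
    by (rule power2_le_imp_le[OF _ mult_nonneg_nonneg, of "\<bar>inner_d d x y\<bar>", unfolded power2_abs])
       (simp_all add: norm_d_def inner_d_def sum_nonneg)
qed

lemma inner_d_vdiff_split: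
  "inner_d d (vdiff x z) u = inner_d d (vdiff x y) u + inner_d d (vdiff y z) u"
  unfolding inner_d_def vdiff_def by (simp add: sum.distrib[symmetric] algebra_simps)

text \<open>Factorising over coordinates reduces integrals over \<open>Rd d\<close> to
  one-dimensional normal integrals.\<close>

lemma gauss_pdf_eq_prod: "gauss_pdf d m x = (\<Prod>k<d. normal_density (m k) 1 (x k))"
proof -
  have "(2 * pi) powr (- real d / 2) = (1 / sqrt (2 * pi)) ^ d"
  proof -
    have "(2 * pi) powr (- real d / 2) = ((2 * pi) powr (- (1 / 2))) powr real d"
      by (simp add: powr_powr)
    also have "(2 * pi) powr (- (1 / 2)) = 1 / sqrt (2 * pi)"
      unfolding powr_minus_divide by (simp add: powr_half_sqrt)
    finally show ?thesis by (simp add: powr_realpow)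
  qed
  then show ?thesis
    unfolding gauss_pdf_def normal_density_def norm_d_power2
    by (simp only: prod.distrib prod_constant exp_sum[symmetric] finite_lessThan card_lessThan)
       (simp add: vdiff_def sum_divide_distrib sum_negf)
qed

lemma gauss_pdf_pos: "0 < gauss_pdf d m x"
  by (simp add: gauss_pdf_def)

lemma space_Rd: "space (Rd d) = {..<d} \<rightarrow>\<^sub>E UNIV"
  by (simp add: Rd_def space_PiM)

lemma sigma_finite_Rd: "sigma_finite_measure (Rd d)"
proof -
  interpret product_sigma_finite "\<lambda>_::nat. lborel :: real measure" ..
  show ?thesis unfolding Rd_def by (rule sigma_finite) simp
qed

lemma measurable_Rd_component [measurable]: "k < d \<Longrightarrow> (\<lambda>x. x k) \<in> borel_measurable (Rd d)"
  unfolding Rd_def by (subst measurable_lborel1[symmetric]) (rule measurable_component_singleton, simp)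

lemma measurable_gauss_pdf [measurable]: "gauss_pdf d m \<in> borel_measurable (Rd d)"
proof -
  have "(\<lambda>x. \<Prod>k<d. normal_density (m k) 1 (x k)) \<in> borel_measurable (Rd d)"
    by (intro borel_measurable_prod) simp
  then show ?thesis by (simp add: gauss_pdf_eq_prod[abs_def])
qed

lemma measurable_inner_d_vdiff [measurable]:
  "(\<lambda>x. inner_d d (vdiff x c) u) \<in> borel_measurable (Rd d)"
  unfolding inner_d_def vdiff_def by (intro borel_measurable_sum) simp

lemma measurable_gmm_pdf [measurable]: "gmm_pdf d M p m \<in> borel_measurable (Rd d)"
  unfolding gmm_pdf_def[abs_def] by measurable

text \<open>The linear form splits over the coordinates, coordinate \<open>k\<close> being tilted by
  \<open>t * u k\<close>; the exponents add up to \<open>t\<^sup>2 / 2\<close> because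
  \<open>u\<close> is a unit vector.\<close>

lemma nn_integral_exp_inner_gauss:
  assumes "norm_d d u = 1"
  shows "(\<integral>\<^sup>+x. ennreal (gauss_pdf d c x * exp (t * inner_d d (vdiff x c) u)) \<partial>Rd d)
    = ennreal (exp (t\<^sup>2 / 2))"
proof -
  interpret product_sigma_finite "\<lambda>_::nat. lborel :: real measure" ..
  have u: "(\<Sum>k<d. (u k)\<^sup>2) = 1"
    using norm_d_power2[of d u] assms by simp
  have "gauss_pdf d c x * exp (t * inner_d d (vdiff x c) u)
      = (\<Prod>k<d. normal_density (c k) 1 (x k) * exp ((t * u k) * (x k - c k)))" for x
    by (simp add: gauss_pdf_eq_prod prod.distrib inner_d_def vdiff_def sum_distrib_left ac_simps
        flip: exp_sum)
  then have "(\<integral>\<^sup>+x. ennreal (gauss_pdf d c x * exp (t * inner_d d (vdiff x c) u)) \<partial>Rd d)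
      = (\<integral>\<^sup>+x. (\<Prod>k<d. ennreal (normal_density (c k) 1 (x k) * exp ((t * u k) * (x k - c k)))) \<partial>Rd d)"
    by (simp add: prod_ennreal)
  also have "\<dots> = (\<Prod>k<d. \<integral>\<^sup>+y. ennreal (normal_density (c k) 1 y * exp ((t * u k) * (y - c k))) \<partial>lborel)"
    unfolding Rd_def by (rule product_nn_integral_prod) auto
  also have "\<dots> = (\<Prod>k<d. ennreal (exp ((t * u k)\<^sup>2 / 2)))"
    by (simp only: nn_integral_exp_normal)
  also have "\<dots> = ennreal (exp (\<Sum>k<d. (t * u k)\<^sup>2 / 2))"
    by (simp add: prod_ennreal exp_sum)
  also have "(\<Sum>k<d. (t * u k)\<^sup>2 / 2) = t\<^sup>2 / 2"
    using u by (simp add: power_mult_distrib flip: sum_distrib_left sum_divide_distrib)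
  finally show ?thesis .
qed

text \<open>Linearising the square by an auxiliary standard Gaussian \<open>z\<close>,
  \<open>exp (c \<xi>\<^sup>2) = E exp (sqrt (2 c) z \<xi>)\<close>, reduces the claim to the moment generating function.\<close>

lemma nn_integral_exp_square_inner_gauss:
  assumes u: "norm_d d u = 1" and c: "0 \<le> c" "c < 1 / 2"
  shows "(\<integral>\<^sup>+x. ennreal (gauss_pdf d m x * exp (c * (inner_d d (vdiff x m) u)\<^sup>2)) \<partial>Rd d)
    = ennreal (1 / sqrt (1 - 2 * c))"
proof -
  interpret R: sigma_finite_measure "Rd d" by (rule sigma_finite_Rd)
  interpret pair_sigma_finite "Rd d" "lborel :: real measure" ..
  define t where "t = sqrt (2 * c)"
  have t2: "t\<^sup>2 = 2 * c" using c by (simp add: t_def)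
  let ?i = "\<lambda>x. inner_d d (vdiff x m) u"
  have "(\<integral>\<^sup>+x. ennreal (gauss_pdf d m x * exp (c * (?i x)\<^sup>2)) \<partial>Rd d)
      = (\<integral>\<^sup>+x. (\<integral>\<^sup>+z. ennreal (gauss_pdf d m x * (std_normal_density z * exp (t * z * ?i x))) \<partial>lborel) \<partial>Rd d)"
  proof (rule nn_integral_cong)
    fix x
    have "ennreal (exp (c * (?i x)\<^sup>2))
        = (\<integral>\<^sup>+z. ennreal (std_normal_density z * exp (t * ?i x * (z - 0))) \<partial>lborel)"
      unfolding nn_integral_exp_normal by (simp add: power_mult_distrib t2)
    then have "ennreal (gauss_pdf d m x * exp (c * (?i x)\<^sup>2))
        = ennreal (gauss_pdf d m x) * (\<integral>\<^sup>+z. ennreal (std_normal_density z * exp (t * ?i x * (z - 0))) \<partial>lborel)"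
      by (simp add: ennreal_mult' gauss_pdf_pos less_imp_le)
    also have "\<dots> = (\<integral>\<^sup>+z. ennreal (gauss_pdf d m x) * ennreal (std_normal_density z * exp (t * ?i x * (z - 0))) \<partial>lborel)"
      by (rule nn_integral_cmult[symmetric]) simp
    also have "\<dots> = (\<integral>\<^sup>+z. ennreal (gauss_pdf d m x * (std_normal_density z * exp (t * z * ?i x))) \<partial>lborel)"
      by (simp add: gauss_pdf_pos less_imp_le ac_simps flip: ennreal_mult')
    finally show "ennreal (gauss_pdf d m x * exp (c * (?i x)\<^sup>2))
      = (\<integral>\<^sup>+z. ennreal (gauss_pdf d m x * (std_normal_density z * exp (t * z * ?i x))) \<partial>lborel)" .
  qed
  \<comment> \<open>After the swap the inner integral is a moment generating function at
    \<open>t * z\<close>, and only a one-dimensional quadratic tilt in \<open>z\<close>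
    remains.\<close>
  also have "\<dots> = (\<integral>\<^sup>+z. (\<integral>\<^sup>+x. ennreal (gauss_pdf d m x * (std_normal_density z * exp (t * z * ?i x))) \<partial>Rd d) \<partial>lborel)"
    by (rule Fubini'[symmetric]) measurable
  also have "\<dots> = (\<integral>\<^sup>+z. ennreal (std_normal_density z * exp (c * z\<^sup>2)) \<partial>lborel)"
  proof (rule nn_integral_cong)
    fix z :: real
    have "(\<integral>\<^sup>+x. ennreal (gauss_pdf d m x * (std_normal_density z * exp (t * z * ?i x))) \<partial>Rd d)
        = (\<integral>\<^sup>+x. ennreal (std_normal_density z) * ennreal (gauss_pdf d m x * exp (t * z * ?i x)) \<partial>Rd d)"
      by (simp add: gauss_pdf_pos less_imp_le ac_simps flip: ennreal_mult')
    also have "\<dots> = ennreal (std_normal_density z) * ennreal (exp ((t * z)\<^sup>2 / 2))"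
      using nn_integral_exp_inner_gauss[OF u, of m "t * z"] by (subst nn_integral_cmult) simp_all
    also have "\<dots> = ennreal (std_normal_density z * exp (c * z\<^sup>2))"
      by (simp add: ennreal_mult' power_mult_distrib t2)
    finally show "(\<integral>\<^sup>+x. ennreal (gauss_pdf d m x * (std_normal_density z * exp (t * z * ?i x))) \<partial>Rd d)
      = ennreal (std_normal_density z * exp (c * z\<^sup>2))" .
  qed
  also have "\<dots> = ennreal (1 / sqrt (1 - 2 * c))"
    using c by (intro nn_integral_exp_square_normal)
  finally show ?thesis .
qed

text \<open>The exponential of an absolute value is at most the sum over both signs, which costs the
  factor 2.\<close>

lemma nn_integral_exp_abs_inner_gauss_le:
  assumes u: "norm_d d u = 1" and "0 \<le> t"
  shows "(\<integral>\<^sup>+x. ennreal (gauss_pdf d c x * exp (t * \<bar>inner_d d (vdiff x c) u\<bar>)) \<partial>Rd d)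
    \<le> ennreal (2 * exp (t\<^sup>2 / 2))"
proof -
  let ?i = "\<lambda>x. inner_d d (vdiff x c) u"
  have "(\<integral>\<^sup>+x. ennreal (gauss_pdf d c x * exp (t * \<bar>?i x\<bar>)) \<partial>Rd d)
     \<le> (\<integral>\<^sup>+x. ennreal (gauss_pdf d c x * exp (t * ?i x)) + ennreal (gauss_pdf d c x * exp (- t * ?i x)) \<partial>Rd d)"
  proof (rule nn_integral_mono)
    fix x
    have "exp (t * \<bar>?i x\<bar>) \<le> exp (t * ?i x) + exp (- t * ?i x)"
      by (cases "0 \<le> ?i x") (auto simp: add_increasing add_increasing2)
    then have "gauss_pdf d c x * exp (t * \<bar>?i x\<bar>)
        \<le> gauss_pdf d c x * exp (t * ?i x) + gauss_pdf d c x * exp (- t * ?i x)"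
      unfolding distrib_left[symmetric] by (intro mult_left_mono) (auto simp: gauss_pdf_pos less_imp_le)
    from ennreal_leI[OF this]
    show "ennreal (gauss_pdf d c x * exp (t * \<bar>?i x\<bar>))
        \<le> ennreal (gauss_pdf d c x * exp (t * ?i x)) + ennreal (gauss_pdf d c x * exp (- t * ?i x))"
      using gauss_pdf_pos[of d c x] by simp
  qed
  also have "\<dots> = ennreal (exp (t\<^sup>2 / 2)) + ennreal (exp ((- t)\<^sup>2 / 2))"
    using nn_integral_exp_inner_gauss[OF u, of c t] nn_integral_exp_inner_gauss[OF u, of c "- t"]
    by (subst nn_integral_add) simp_all
  also have "\<dots> = ennreal (2 * exp (t\<^sup>2 / 2))"
    by (simp flip: ennreal_plus)
  finally show ?thesis .
qed

section \<open>Expectations under the mixture\<close>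

lemma nn_integral_GMM:
  assumes [measurable]: "f \<in> borel_measurable (Rd d)" and "\<And>x. 0 \<le> f x"
    and "\<And>i. i \<in> {1..M} \<Longrightarrow> 0 < p i"
  shows "(\<integral>\<^sup>+x. ennreal (f x) \<partial>GMM d M p m)
    = (\<Sum>i\<in>{1..M}. ennreal (p i) * (\<integral>\<^sup>+x. ennreal (gauss_pdf d (m i) x * f x) \<partial>Rd d))"
proof -
  have "(\<integral>\<^sup>+x. ennreal (f x) \<partial>GMM d M p m)
      = (\<integral>\<^sup>+x. ennreal (gmm_pdf d M p m x) * ennreal (f x) \<partial>Rd d)"
    unfolding GMM_def by (rule nn_integral_density) measurable
  also have "\<dots> = (\<integral>\<^sup>+x. (\<Sum>i\<in>{1..M}. ennreal (p i) * ennreal (gauss_pdf d (m i) x * f x)) \<partial>Rd d)"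
  proof (rule nn_integral_cong)
    fix x
    have "ennreal (gmm_pdf d M p m x) * ennreal (f x) = ennreal (gmm_pdf d M p m x * f x)"
      using assms by (intro ennreal_mult'[symmetric]) (auto simp: gmm_pdf_def gauss_pdf_pos less_imp_le intro!: sum_nonneg)
    also have "gmm_pdf d M p m x * f x = (\<Sum>i\<in>{1..M}. p i * (gauss_pdf d (m i) x * f x))"
      unfolding gmm_pdf_def sum_distrib_right by (simp add: ac_simps)
    also have "ennreal \<dots> = (\<Sum>i\<in>{1..M}. ennreal (p i * (gauss_pdf d (m i) x * f x)))"
      using assms by (intro sum_ennreal[symmetric]) (auto simp: gauss_pdf_pos less_imp_le)
    also have "\<dots> = (\<Sum>i\<in>{1..M}. ennreal (p i) * ennreal (gauss_pdf d (m i) x * f x))"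
      using assms by (intro sum.cong ennreal_mult') (auto simp: less_imp_le)
    finally show "ennreal (gmm_pdf d M p m x) * ennreal (f x)
      = (\<Sum>i\<in>{1..M}. ennreal (p i) * ennreal (gauss_pdf d (m i) x * f x))" .
  qed
  also have "\<dots> = (\<Sum>i\<in>{1..M}. ennreal (p i) * (\<integral>\<^sup>+x. ennreal (gauss_pdf d (m i) x * f x) \<partial>Rd d))"
    by (subst nn_integral_sum) (simp_all add: nn_integral_cmult)
  finally show ?thesis .
qed

text \<open>The weights sum to 1, so a bound common to all components passes to the mixture with no
  loss in \<open>M\<close> or in the weights.\<close>

lemma nn_integral_GMM_le:
  assumes "f \<in> borel_measurable (Rd d)" and "\<And>x. 0 \<le> f x"
    and p: "\<And>i. i \<in> {1..M} \<Longrightarrow> 0 < p i" "(\<Sum>i\<in>{1..M}. p i) = 1"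
    and le: "\<And>i. i \<in> {1..M} \<Longrightarrow> (\<integral>\<^sup>+x. ennreal (gauss_pdf d (m i) x * f x) \<partial>Rd d) \<le> B"
  shows "(\<integral>\<^sup>+x. ennreal (f x) \<partial>GMM d M p m) \<le> B"
proof -
  have "(\<integral>\<^sup>+x. ennreal (f x) \<partial>GMM d M p m) \<le> (\<Sum>i\<in>{1..M}. ennreal (p i) * B)"
    using assms by (subst nn_integral_GMM) (auto intro!: sum_mono mult_left_mono)
  also have "\<dots> = B"
    unfolding sum_distrib_right[symmetric]
    using p by (subst sum_ennreal) (auto simp: less_imp_le)
  finally show ?thesis .
qed

lemma sets_GMM [measurable_cong]: "sets (GMM d M p m) = sets (Rd d)"
  by (simp add: GMM_def)

lemma prob_space_GMM:
  assumes u: "norm_d d u = 1"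
    and p: "\<And>i. i \<in> {1..M} \<Longrightarrow> 0 < p i" "(\<Sum>i\<in>{1..M}. p i) = 1"
  shows "prob_space (GMM d M p m)"
proof
  have "emeasure (GMM d M p m) (space (GMM d M p m)) = (\<integral>\<^sup>+x. ennreal 1 \<partial>GMM d M p m)"
    by simp
  also have "\<dots> = (\<Sum>i\<in>{1..M}. ennreal (p i) * (\<integral>\<^sup>+x. ennreal (gauss_pdf d (m i) x * 1) \<partial>Rd d))"
    using p by (intro nn_integral_GMM) auto
  \<comment> \<open>Each component has mass 1 as the case \<open>t = 0\<close> of the moment
    generating function; this is where \<open>u\<close> enters.\<close>
  also have "\<dots> = (\<Sum>i\<in>{1..M}. ennreal (p i))"
    using nn_integral_exp_inner_gauss[OF u, of _ 0] by simp
  also have "\<dots> = ennreal (\<Sum>i\<in>{1..M}. p i)" by (intro sum_ennreal less_imp_le p)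
  also have "\<dots> = 1" unfolding p(2) by simp
  finally show "emeasure (GMM d M p m) (space (GMM d M p m)) = 1" .
qed

section \<open>Elementary inequalities and the product majorant\<close>

text \<open>For nonnegative arguments two monotonicity arguments are chained:
  \<open>z * cosh z - sinh z\<close> has derivative \<open>z * sinh z\<close>, and its sign is that
  of the derivative of \<open>z\<^sup>2 / 2 - ln (cosh z)\<close>.\<close>

lemma cosh_le_exp_half_square: "cosh x \<le> exp (x\<^sup>2 / 2)" for x :: real
proof -
  have sinh_le: "sinh y \<le> y * cosh y" if "0 \<le> y" for y :: real
  proof -
    have "0 * cosh 0 - sinh 0 \<le> y * cosh y - sinh y"
    proof (rule DERIV_nonneg_imp_nondecreasing[OF that])
      fix z :: real assume "0 \<le> z"
      have "((\<lambda>z. z * cosh z - sinh z) has_real_derivative z * sinh z) (at z)"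
        by (auto intro!: derivative_eq_intros)
      then show "\<exists>D. ((\<lambda>z. z * cosh z - sinh z) has_real_derivative D) (at z) \<and> 0 \<le> D"
        using \<open>0 \<le> z\<close> by (intro exI[of _ "z * sinh z"]) simp
    qed
    then show ?thesis by simp
  qed
  have "cosh y \<le> exp (y\<^sup>2 / 2)" if "0 \<le> y" for y :: real
  proof -
    have "0\<^sup>2 / 2 - ln (cosh 0) \<le> y\<^sup>2 / 2 - ln (cosh y)"
    proof (rule DERIV_nonneg_imp_nondecreasing[OF that])
      fix z :: real assume "0 \<le> z"
      have "((\<lambda>z. z\<^sup>2 / 2 - ln (cosh z)) has_real_derivative z - sinh z / cosh z) (at z)"
        by (auto intro!: derivative_eq_intros simp: field_simps)
      moreover have "0 \<le> z - sinh z / cosh z"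
        using sinh_le[OF \<open>0 \<le> z\<close>] by (simp add: divide_le_eq)
      ultimately show "\<exists>D. ((\<lambda>z. z\<^sup>2 / 2 - ln (cosh z)) has_real_derivative D) (at z) \<and> 0 \<le> D"
        by blast
    qed
    then have "ln (cosh y) \<le> y\<^sup>2 / 2" by simp
    then show ?thesis by (metis cosh_real_pos exp_le_cancel_iff exp_ln)
  qed
  from this[of "\<bar>x\<bar>"] show ?thesis by (simp add: cosh_real_abs)
qed

text \<open>Rests on \<open>(1 - 2 * c) * (1 + 4 * c) = 1 + 2 * c * (1 - 4 * c)\<close>, which is at
  least 1 in the given range.\<close>

lemma inverse_sqrt_le_exp:
  fixes c :: real
  assumes "0 \<le> c" "4 * c \<le> 1"
  shows "1 / sqrt (1 - 2 * c) \<le> exp (2 * c)"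
proof -
  have "1 \<le> (1 - 2 * c) * (1 + 4 * c)"
    using mult_nonneg_nonneg[of c "1 - 4 * c"] assms by (simp add: algebra_simps)
  also have "\<dots> \<le> (1 - 2 * c) * exp (4 * c)"
    using assms exp_ge_add_one_self[of "4 * c"] by (intro mult_left_mono) auto
  finally have "sqrt 1 \<le> sqrt ((1 - 2 * c) * exp (4 * c))" by simp
  also have "\<dots> = sqrt (1 - 2 * c) * exp (2 * c)"
  proof -
    have "exp (4 * c) = (exp (2 * c))\<^sup>2" by (simp flip: exp_double)
    then show ?thesis by (simp add: real_sqrt_mult)
  qed
  finally show ?thesis using assms by (simp add: field_simps)
qed

text \<open>The two regimes: for small \<open>l\<close> use \<open>cosh z \<le> exp (z\<^sup>2 / 2)\<close> together with
  \<open>(s + t)\<^sup>2 \<le> 2 s\<^sup>2 + 2 t\<^sup>2\<close>, for large \<open>l\<close> just \<open>cosh z \<le> exp z\<close>.\<close>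

lemma GMM_cosh_majorant:
  fixes l r a :: real
  assumes u: "norm_d d u = 1"
    and p: "\<And>i. i \<in> {1..M} \<Longrightarrow> 0 < p i" "(\<Sum>i\<in>{1..M}. p i) = 1"
    and near: "\<And>i. i \<in> {1..M} \<Longrightarrow> \<bar>inner_d d (vdiff (m i) c) u\<bar> + a \<le> r / 2"
    and a: "0 \<le> a" and r: "12 \<le> r" and l: "0 \<le> l"
  defines "h \<equiv> \<lambda>x. \<bar>inner_d d (vdiff x c) u\<bar> + a"
  shows "\<exists>k. integrable (GMM d M p m) k \<and> (\<integral>x. k x \<partial>GMM d M p m) \<le> exp (((1 + r) * l)\<^sup>2 / 2)
    \<and> (\<forall>x. 0 \<le> k x) \<and> (\<forall>x y. cosh (l * h x + l * h y) \<le> k x * k y)"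
proof -
  have h0: "0 \<le> h x" for x using a by (simp add: h_def)
  have [measurable]: "h \<in> borel_measurable (Rd d)" unfolding h_def by measurable
  have h_le: "h x \<le> \<bar>inner_d d (vdiff x (m i)) u\<bar> + r / 2" if "i \<in> {1..M}" for i x
    using near[OF that] inner_d_vdiff_split[of d x c u "m i"] unfolding h_def by linarith
  obtain k where [measurable]: "k \<in> borel_measurable (Rd d)" and k0: "\<And>x. 0 \<le> k x"
    and hk: "\<And>x y. cosh (l * h x + l * h y) \<le> k x * k y"
    and comp: "\<And>i. i \<in> {1..M} \<Longrightarrow> (\<integral>\<^sup>+x. ennreal (gauss_pdf d (m i) x * k x) \<partial>Rd d)
        \<le> ennreal (exp (((1 + r) * l)\<^sup>2 / 2))"
  \<comment> \<open>Below the threshold, \<open>r \<ge> 12\<close> forces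
    \<open>l \<le> 1 / 6\<close>, so the Gaussian integral of the squared exponential is finite.
    Above it, \<open>r * l / 2 + 1 \<le> (r * l)\<^sup>2 / 2\<close>, with equality at
    \<open>r * l = 2\<close>.\<close>
  proof (cases "r * l \<le> 2")
    case True
    show ?thesis
    proof (rule that[of "\<lambda>x. exp ((l * h x)\<^sup>2)"])
      show "cosh (l * h x + l * h y) \<le> exp ((l * h x)\<^sup>2) * exp ((l * h y)\<^sup>2)" for x y
      proof -
        have "(l * h x + l * h y)\<^sup>2 / 2 \<le> (l * h x)\<^sup>2 + (l * h y)\<^sup>2"
          using zero_le_power2[of "l * h x - l * h y"] by (simp add: power2_sum power2_diff)
        then show ?thesis
          by (intro order_trans[OF cosh_le_exp_half_square]) (simp flip: exp_add)
      qed
      fix i assume i: "i \<in> {1..M}"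
      let ?i = "\<lambda>x. inner_d d (vdiff x (m i)) u"
      have l2: "144 * l\<^sup>2 \<le> (r * l)\<^sup>2"
        using r by (auto simp: power_mult_distrib intro!: mult_right_mono power_mono[of 12 r 2, simplified])
      have "(r * l)\<^sup>2 \<le> 2\<^sup>2" using True r l by (intro power_mono) auto
      then have c: "4 * (3 * l\<^sup>2) \<le> 1" using l2 by simp
      \<comment> \<open>With s the absolute value of the linear form, \<open>3 / 8 * r\<^sup>2 + 3 *
        s\<^sup>2 - (s + r / 2)\<^sup>2 = (4 * s - r)\<^sup>2 / 8\<close>. The coefficient 3/8 stays
        below the target 1/2, and the spare \<open>(r * l)\<^sup>2 / 8 \<ge> 18 * l\<^sup>2\<close>
        absorbs the term \<open>6 * l\<^sup>2\<close> arising below.\<close>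
      have pw: "(l * h x)\<^sup>2 \<le> 3 / 8 * (r * l)\<^sup>2 + 3 * l\<^sup>2 * (?i x)\<^sup>2" for x
      proof -
        have "(h x)\<^sup>2 \<le> (\<bar>?i x\<bar> + r / 2)\<^sup>2" using h_le[OF i] h0 by (intro power_mono) auto
        also have "\<dots> \<le> 3 / 8 * r\<^sup>2 + 3 * (?i x)\<^sup>2"
          using zero_le_power2[of "4 * \<bar>?i x\<bar> - r"] by (simp add: power2_sum power2_diff algebra_simps power_divide)
        finally have "l\<^sup>2 * (h x)\<^sup>2 \<le> l\<^sup>2 * (3 / 8 * r\<^sup>2 + 3 * (?i x)\<^sup>2)"
          by (intro mult_left_mono) auto
        then show ?thesis by (simp add: power_mult_distrib algebra_simps)
      qed
      have "(\<integral>\<^sup>+x. ennreal (gauss_pdf d (m i) x * exp ((l * h x)\<^sup>2)) \<partial>Rd d)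
         \<le> (\<integral>\<^sup>+x. ennreal (exp (3 / 8 * (r * l)\<^sup>2)) *
               ennreal (gauss_pdf d (m i) x * exp (3 * l\<^sup>2 * (?i x)\<^sup>2)) \<partial>Rd d)"
      proof (rule nn_integral_mono)
        fix x
        have "exp ((l * h x)\<^sup>2) \<le> exp (3 / 8 * (r * l)\<^sup>2) * exp (3 * l\<^sup>2 * (?i x)\<^sup>2)"
          using pw[of x] by (simp flip: exp_add)
        then have "gauss_pdf d (m i) x * exp ((l * h x)\<^sup>2)
            \<le> exp (3 / 8 * (r * l)\<^sup>2) * (gauss_pdf d (m i) x * exp (3 * l\<^sup>2 * (?i x)\<^sup>2))"
          using mult_left_mono[OF _ less_imp_le[OF gauss_pdf_pos[of d "m i" x]]]
          by (simp add: mult.left_commute)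
        then show "ennreal (gauss_pdf d (m i) x * exp ((l * h x)\<^sup>2))
          \<le> ennreal (exp (3 / 8 * (r * l)\<^sup>2)) * ennreal (gauss_pdf d (m i) x * exp (3 * l\<^sup>2 * (?i x)\<^sup>2))"
          by (subst ennreal_mult'[symmetric]) (auto intro!: ennreal_leI)
      qed
      also have "\<dots> = ennreal (exp (3 / 8 * (r * l)\<^sup>2)) * ennreal (1 / sqrt (1 - 2 * (3 * l\<^sup>2)))"
        using c by (subst nn_integral_cmult) (simp_all add: nn_integral_exp_square_inner_gauss[OF u])
      also have "\<dots> \<le> ennreal (exp (3 / 8 * (r * l)\<^sup>2)) * ennreal (exp (2 * (3 * l\<^sup>2)))"
        using c inverse_sqrt_le_exp[of "3 * l\<^sup>2"] by (intro mult_left_mono ennreal_leI) auto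
      also have "\<dots> = ennreal (exp (3 / 8 * (r * l)\<^sup>2 + 6 * l\<^sup>2))"
        by (simp add: exp_add flip: ennreal_mult')
      also have "\<dots> \<le> ennreal (exp (((1 + r) * l)\<^sup>2 / 2))"
      proof -
        have "(r * l)\<^sup>2 \<le> ((1 + r) * l)\<^sup>2" using r l by (intro power_mono mult_right_mono) auto
        then show ?thesis using l2 zero_le_power2[of l]
          by (intro ennreal_leI exp_le_cancel_iff[THEN iffD2]) linarith
      qed
      finally show "(\<integral>\<^sup>+x. ennreal (gauss_pdf d (m i) x * exp ((l * h x)\<^sup>2)) \<partial>Rd d)
        \<le> ennreal (exp (((1 + r) * l)\<^sup>2 / 2))" .
    qed auto
  next
    case False
    show ?thesis
    proof (rule that[of "\<lambda>x. exp (l * h x)"])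
      show "cosh (l * h x + l * h y) \<le> exp (l * h x) * exp (l * h y)" for x y
      proof -
        have "0 \<le> l * h x + l * h y" using l h0 by simp
        then have "exp (- (l * h x + l * h y)) \<le> exp (l * h x + l * h y)" by simp
        then show ?thesis by (simp add: cosh_def flip: exp_add)
      qed
      fix i assume i: "i \<in> {1..M}"
      let ?i = "\<lambda>x. inner_d d (vdiff x (m i)) u"
      have "(\<integral>\<^sup>+x. ennreal (gauss_pdf d (m i) x * exp (l * h x)) \<partial>Rd d)
         \<le> (\<integral>\<^sup>+x. ennreal (exp (r * l / 2)) * ennreal (gauss_pdf d (m i) x * exp (l * \<bar>?i x\<bar>)) \<partial>Rd d)"
      proof (rule nn_integral_mono)
        fix x
        have "l * h x \<le> r * l / 2 + l * \<bar>?i x\<bar>"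
          using mult_left_mono[OF h_le[OF i, of x] l] by (simp add: algebra_simps)
        then have "exp (l * h x) \<le> exp (r * l / 2) * exp (l * \<bar>?i x\<bar>)"
          by (simp flip: exp_add)
        then have "gauss_pdf d (m i) x * exp (l * h x)
            \<le> exp (r * l / 2) * (gauss_pdf d (m i) x * exp (l * \<bar>?i x\<bar>))"
          using mult_left_mono[OF _ less_imp_le[OF gauss_pdf_pos[of d "m i" x]]]
          by (simp add: mult.left_commute)
        then show "ennreal (gauss_pdf d (m i) x * exp (l * h x))
          \<le> ennreal (exp (r * l / 2)) * ennreal (gauss_pdf d (m i) x * exp (l * \<bar>?i x\<bar>))"
          by (subst ennreal_mult'[symmetric]) (auto intro!: ennreal_leI)
      qed
      also have "\<dots> \<le> ennreal (exp (r * l / 2)) * ennreal (2 * exp (l\<^sup>2 / 2))"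
        using nn_integral_exp_abs_inner_gauss_le[OF u l, of "m i"]
        by (subst nn_integral_cmult) (auto intro!: mult_left_mono)
      \<comment> \<open>The factor 2 is moved into the exponent as the summand 1.\<close>
      also have "\<dots> \<le> ennreal (exp (r * l / 2)) * ennreal (exp 1 * exp (l\<^sup>2 / 2))"
        using exp_ge_add_one_self[of 1] by (intro mult_left_mono ennreal_leI mult_right_mono) auto
      also have "\<dots> = ennreal (exp (r * l / 2 + (1 + l\<^sup>2 / 2)))"
        by (simp add: exp_add flip: ennreal_mult')
      also have "\<dots> \<le> ennreal (exp (((1 + r) * l)\<^sup>2 / 2))"
      proof -
        have "0 \<le> (r * l - 2) * (r * l + 1)" using False l r by (intro mult_nonneg_nonneg) auto
        moreover have "((1 + r) * l)\<^sup>2 = l\<^sup>2 + 2 * r * l\<^sup>2 + (r * l) * (r * l)"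
          by (simp add: power2_eq_square algebra_simps)
        moreover have "0 \<le> 2 * r * l\<^sup>2" using r by simp
        ultimately show ?thesis by (intro ennreal_leI) (simp add: algebra_simps)
      qed
      finally show "(\<integral>\<^sup>+x. ennreal (gauss_pdf d (m i) x * exp (l * h x)) \<partial>Rd d)
        \<le> ennreal (exp (((1 + r) * l)\<^sup>2 / 2))" .
    qed auto
  qed
  have le: "(\<integral>\<^sup>+x. ennreal (k x) \<partial>GMM d M p m) \<le> ennreal (exp (((1 + r) * l)\<^sup>2 / 2))"
    using p k0 comp by (intro nn_integral_GMM_le) auto
  have int: "integrable (GMM d M p m) k"
  proof (rule integrableI_nonneg)
    show "(\<integral>\<^sup>+x. ennreal (k x) \<partial>GMM d M p m) < \<infinity>"
      using le by (simp add: le_less_trans[OF _ ennreal_less_top])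
  qed (use k0 in auto)
  have "ennreal (\<integral>x. k x \<partial>GMM d M p m) \<le> ennreal (exp (((1 + r) * l)\<^sup>2 / 2))"
    using le nn_integral_eq_integral[OF int] k0 by simp
  then have "(\<integral>x. k x \<partial>GMM d M p m) \<le> exp (((1 + r) * l)\<^sup>2 / 2)"
    by (simp add: ennreal_le_iff)
  with int k0 hk show ?thesis by blast
qed

subsection \<open>The supremum over the region\<close>

lemma w1_nonneg_le_1:
  assumes "1 \<le> M" "\<And>i. i \<in> {1..M} \<Longrightarrow> 0 < p i"
  shows "0 \<le> w1 d M p mu x" "w1 d M p mu x \<le> 1"
proof -
  have "p 1 * gauss_pdf d (mu 1) x \<le> gmm_pdf d M p mu x"
    unfolding gmm_pdf_def using assms
    by (intro member_le_sum[of 1 "{1..M}" "\<lambda>i. p i * gauss_pdf d (mu i) x"])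
       (auto simp: gauss_pdf_pos less_imp_le)
  moreover have "0 < p 1 * gauss_pdf d (mu 1) x" using assms by (simp add: gauss_pdf_pos)
  ultimately show "0 \<le> w1 d M p mu x" "w1 d M p mu x \<le> 1"
    by (simp_all add: w1_def)
qed

lemma gmm_pdf_pos:
  assumes "1 \<le> M" "\<And>i. i \<in> {1..M} \<Longrightarrow> 0 < p i"
  shows "0 < gmm_pdf d M p mu x"
  unfolding gmm_pdf_def using assms by (intro sum_pos) (auto simp: gauss_pdf_pos)

text \<open>The weight lies in [0, 1], and moving the first centre by at most \<open>a\<close>
  changes the linear form by at most \<open>a\<close>. The bound is the same for every
  \<open>mu\<close> in the region, so it survives the supremum.\<close>

lemma abs_weighted_inner_le:
  assumes "1 \<le> M" "\<And>i. i \<in> {1..M} \<Longrightarrow> 0 < p i"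
    and u: "norm_d d u = 1" and mu: "mu \<in> regionA d M m a"
  shows "\<bar>w1 d M p mu x * inner_d d (vdiff x (mu 1)) u\<bar> \<le> \<bar>inner_d d (vdiff x (m 1)) u\<bar> + a"
proof -
  have "norm_d d (vdiff (mu 1) (m 1)) \<le> a"
    using mu \<open>1 \<le> M\<close> by (auto simp: regionA_def PiE_def Pi_def)
  then have "\<bar>inner_d d (vdiff (mu 1) (m 1)) u\<bar> \<le> a"
    using abs_inner_d_le[of d "vdiff (mu 1) (m 1)" u] u by simp
  then have "\<bar>inner_d d (vdiff x (mu 1)) u\<bar> \<le> \<bar>inner_d d (vdiff x (m 1)) u\<bar> + a"
    using inner_d_vdiff_split[of d x "m 1" u "mu 1"] by linarith
  moreover have "\<bar>w1 d M p mu x * inner_d d (vdiff x (mu 1)) u\<bar> \<le> \<bar>inner_d d (vdiff x (mu 1)) u\<bar>"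
    using w1_nonneg_le_1[OF assms(1,2)]
    unfolding abs_mult by (intro mult_left_le_one_le) auto
  ultimately show ?thesis by linarith
qed

text \<open>Continuity refers to the product topology on all functions from \<open>nat\<close> to
  \<open>real\<close>; it serves the measurability of a supremum over an uncountable region.\<close>

lemma continuous_on_weighted_inner:
  assumes "1 \<le> M" "\<And>i. i \<in> {1..M} \<Longrightarrow> 0 < p i"
  shows "continuous_on UNIV (\<lambda>x. w1 d M p mu x * inner_d d (vdiff x c) u)"
proof -
  have "continuous_on UNIV (\<lambda>x. gauss_pdf d c x)" for c
    unfolding gauss_pdf_def norm_d_power2 vdiff_def
    by (intro continuous_intros continuous_on_product_coordinates) auto
  moreover from this have "continuous_on UNIV (\<lambda>x. gmm_pdf d M p mu x)"
    unfolding gmm_pdf_def by (intro continuous_intros)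
  ultimately show ?thesis
    unfolding w1_def inner_d_def vdiff_def
    using gmm_pdf_pos[of M p d mu] assms
    by (intro continuous_intros continuous_on_product_coordinates) (auto simp: less_imp_neq[symmetric])
qed

lemma abs_SUP_diff_le:
  fixes F F' :: "'a \<Rightarrow> real"
  assumes "A \<noteq> {}" "bdd_above (F ` A)" "bdd_above (F' ` A)"
    and le: "\<And>x. x \<in> A \<Longrightarrow> \<bar>F x - F' x\<bar> \<le> \<delta>"
  shows "\<bar>(SUP x\<in>A. F x) - (SUP x\<in>A. F' x)\<bar> \<le> \<delta>"
proof -
  have "(SUP x\<in>A. F x) \<le> (SUP x\<in>A. F' x) + \<delta>"
  proof (rule cSUP_least[OF \<open>A \<noteq> {}\<close>])
    fix x assume "x \<in> A"
    then show "F x \<le> (SUP x\<in>A. F' x) + \<delta>"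
      using le[of x] cSUP_upper[OF _ assms(3), of x] by linarith
  qed
  moreover have "(SUP x\<in>A. F' x) \<le> (SUP x\<in>A. F x) + \<delta>"
  proof (rule cSUP_least[OF \<open>A \<noteq> {}\<close>])
    fix x assume "x \<in> A"
    then show "F' x \<le> (SUP x\<in>A. F x) + \<delta>"
      using le[of x] cSUP_upper[OF _ assms(2), of x] by linarith
  qed
  ultimately show ?thesis by linarith
qed

section \<open>Measurability of the supremum\<close>

text \<open>Links the product sigma-algebra of the sample with the Borel sets of the product
  topology, in which the continuity argument lives. Coordinates beyond \<open>n\<close> or
  \<open>d\<close> are constant on the sample space.\<close>

lemma measurable_sample_borel:
  "(\<lambda>X. X) \<in> borel_measurable (sample d M p m n)"
proof (intro measurable_coordinatewise_then_product)
  fix j k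
  show "(\<lambda>X. X j k) \<in> borel_measurable (sample d M p m n)"
  proof (cases "j < n")
    case j: True
    have comp: "(\<lambda>X. X j) \<in> measurable (sample d M p m n) (Rd d)"
      unfolding sample_def
      using measurable_component_singleton[of j "{..<n}" "\<lambda>_. GMM d M p m"] j
      by (simp add: measurable_cong_sets[OF refl sets_GMM])
    show ?thesis
    proof (cases "k < d")
      case True
      from measurable_compose[OF comp measurable_Rd_component[OF True]] show ?thesis .
    next
      case False
      have "X j k = undefined" if "X \<in> space (sample d M p m n)" for X
        using measurable_space[OF comp that] False by (auto simp: space_Rd PiE_def extensional_def)
      then show ?thesis by (subst measurable_cong[where g = "\<lambda>_. undefined"]) auto
    qed
  next
    case False
    \<comment> \<open>Here the whole vector \<open>X j\<close> is the default function, unlike the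
      case \<open>k \<ge> d\<close>, where a single entry is the default real.\<close>
    have "X j k = undefined k" if "X \<in> space (sample d M p m n)" for X
      using that False by (auto simp: sample_def space_PiM PiE_def extensional_def)
    then show ?thesis by (subst measurable_cong[where g = "\<lambda>_. undefined k"]) auto
  qed
qed

text \<open>A supremum of continuous functions is lower semicontinuous: its strict superlevel sets
  are unions of open sets, whatever the cardinality of \<open>A\<close>.\<close>

lemma measurable_SUP_continuous:
  fixes F :: "'i \<Rightarrow> 'a::topological_space \<Rightarrow> real"
  assumes "A \<noteq> {}" "\<And>x. bdd_above ((\<lambda>i. F i x) ` A)"
    and "\<And>i. i \<in> A \<Longrightarrow> continuous_on UNIV (F i)"
  shows "(\<lambda>x. SUP i\<in>A. F i x) \<in> borel_measurable borel"
proof (unfold borel_measurable_iff_greater, intro allI)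
  fix c
  have "{x \<in> space borel. c < (SUP i\<in>A. F i x)} = (\<Union>i\<in>A. {x. c < F i x})"
    using assms(1,2) by (auto simp: less_cSUP_iff)
  moreover have "open (\<Union>i\<in>A. {x. c < F i x})"
    using assms(3) by (intro open_UN ballI open_Collect_less) auto
  ultimately show "{x \<in> space borel. c < (SUP i\<in>A. F i x)} \<in> sets borel" by simp
qed

section \<open>Consequences of the separation assumption\<close>

text \<open>The factors satisfy \<open>M \<ge> 2\<close>, \<open>kappa M p \<ge> 1\<close> and
  \<open>pi_min M p \<le> 1\<close>. As 4 exceeds e, the logarithm in the separation assumption is
  at least 1.\<close>

lemma weight_scale_ge_4:
  assumes M: "2 \<le> M" and p: "\<And>i. i \<in> {1..M} \<Longrightarrow> 0 < p i" "(\<Sum>i\<in>{1..M}. p i) = 1"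
  shows "4 \<le> real M ^ 2 * kappa M p / pi_min M p"
proof -
  let ?P = "p ` {1..M}"
  have fin: "finite ?P" "?P \<noteq> {}" using M by auto
  have pos: "0 < Min ?P" using fin p by (subst Min_gr_iff) auto
  have "Min ?P \<le> p 1" using fin M by (intro Min_le) auto
  also have "p 1 \<le> (\<Sum>i\<in>{1..M}. p i)"
    using p M by (intro member_le_sum) (auto simp: less_imp_le)
  finally have le1: "Min ?P \<le> 1" using p by simp
  have "Min ?P \<le> Max ?P" using fin by (meson Max_ge Min_in)
  then have kap: "1 \<le> kappa M p" using pos by (simp add: kappa_def)
  have "4 \<le> real M ^ 2" using power_mono[of 2 "real M" 2] M by simp
  then have "4 * 1 \<le> real M ^ 2 * kappa M p" using kap by (intro mult_mono) auto
  also have "\<dots> \<le> real M ^ 2 * kappa M p / pi_min M p"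
    using pos le1 kap by (simp add: pi_min_def le_divide_eq mult_left_le)
  finally show ?thesis by simp
qed

lemma Rmax_ge_Rmin_le:
  assumes "i \<in> {1..M}" "j \<in> {1..M}" "i \<noteq> j"
  shows "norm_d d (vdiff (m i) (m j)) \<le> Rmax d M m" "Rmin d M m \<le> norm_d d (vdiff (m i) (m j))"
proof -
  let ?S = "{norm_d d (vdiff (m i) (m j)) | i j. i \<in> {1..M} \<and> j \<in> {1..M} \<and> i \<noteq> j}"
  have "?S \<subseteq> (\<lambda>(i, j). norm_d d (vdiff (m i) (m j))) ` ({1..M} \<times> {1..M})" by auto
  then have "finite ?S" by (rule finite_subset) simp
  then show "norm_d d (vdiff (m i) (m j)) \<le> Rmax d M m" "Rmin d M m \<le> norm_d d (vdiff (m i) (m j))"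
    unfolding Rmax_def Rmin_def using assms by (auto intro!: Max_ge Min_le)
qed

text \<open>The constant hidden in the O-notation is \<open>C\<close>, chosen before all parameters
  and hence universal. The lower bound on \<open>Rmin\<close> is expressed by
  \<open>0 \<le> a\<close> together with the upper bound on \<open>a\<close>.\<close>

theorem theorem7:
  shows "\<exists>C>0. \<forall>(M::nat) (d::nat) (p::nat \<Rightarrow> real) (m::nat \<Rightarrow> nat \<Rightarrow> real) (a::real)
            (u::nat \<Rightarrow> real) (n::nat).
     M \<ge> 2 \<and> d \<ge> 1 \<and> n \<ge> 1
     \<and> (\<forall>i\<in>{1..M}. p i > 0) \<and> (\<Sum>i\<in>{1..M}. p i) = 1
     \<and> (\<forall>i\<in>{1..M}. m i \<in> space (Rd d))
     \<and> (\<forall>k<d. (\<Sum>i\<in>{1..M}. p i * m i k) = 0)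
     \<and> 0 \<le> a
     \<and> a \<le> Rmin d M m / 2 - sqrt (real (min d M)) * (C * sqrt (ln (max (max
              (real M ^ 2 * kappa M p / pi_min M p) (Rmax d M m)) (real (min d M)))))
     \<and> u \<in> space (Rd d) \<and> norm_d d u = 1
     \<longrightarrow> measure (sample d M p m n)
           {Xs \<in> space (sample d M p m n).
              gsup d M p m a u n Xs - (\<integral>Ys. gsup d M p m a u n Ys \<partial>sample d M p m n)
                > 2 * (1 + 3 * Rmax d M m) * sqrt (real d * ln (real n) / real n)}
         \<le> 1 / real n ^ d"
\<comment> \<open>With \<open>C = 2\<close> both square roots in the assumption are at least 1, so
  \<open>Rmin / 2 \<ge> 2\<close>. This gives \<open>Rmax \<ge> 4\<close>, that is
  \<open>3 * Rmax \<ge> 12\<close>, as the majorant requires.\<close>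
proof (intro exI[of _ 2] conjI allI impI)
  fix M d :: nat and p :: "nat \<Rightarrow> real" and m :: "nat \<Rightarrow> nat \<Rightarrow> real" and a :: real
    and u :: "nat \<Rightarrow> real" and n :: nat
  let ?L = "max (max (real M ^ 2 * kappa M p / pi_min M p) (Rmax d M m)) (real (min d M))"
  assume *: "M \<ge> 2 \<and> d \<ge> 1 \<and> n \<ge> 1
     \<and> (\<forall>i\<in>{1..M}. p i > 0) \<and> (\<Sum>i\<in>{1..M}. p i) = 1
     \<and> (\<forall>i\<in>{1..M}. m i \<in> space (Rd d))
     \<and> (\<forall>k<d. (\<Sum>i\<in>{1..M}. p i * m i k) = 0)
     \<and> 0 \<le> a
     \<and> a \<le> Rmin d M m / 2 - sqrt (real (min d M)) * (2 * sqrt (ln ?L))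
     \<and> u \<in> space (Rd d) \<and> norm_d d u = 1"
  then have M: "2 \<le> M" "1 \<le> M" and d: "1 \<le> d" and n: "1 \<le> n"
    and p: "\<And>i. i \<in> {1..M} \<Longrightarrow> 0 < p i" "(\<Sum>i\<in>{1..M}. p i) = 1"
    and m: "\<And>i. i \<in> {1..M} \<Longrightarrow> m i \<in> space (Rd d)"
    and a: "0 \<le> a" "a \<le> Rmin d M m / 2 - sqrt (real (min d M)) * (2 * sqrt (ln ?L))"
    and u: "norm_d d u = 1"
    by auto
  let ?N = "GMM d M p m" and ?P = "sample d M p m n" and ?A = "regionA d M m a"
  interpret N: prob_space ?N by (rule prob_space_GMM[OF u p])
  interpret P: prob_space ?P unfolding sample_def by (intro prob_space_PiM N.prob_space_axioms)

  \<comment> \<open>Half of \<open>r\<close> covers a distance between centres, at most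
    \<open>Rmax\<close>, plus the radius \<open>a\<close>, at most \<open>Rmax / 2\<close>.\<close>
  define r where "r = 3 * Rmax d M m"
  have "exp 1 \<le> ?L" using exp_le weight_scale_ge_4[OF M(1) p] by linarith
  then have "1 \<le> ln ?L" by (subst ln_ge_iff) (auto intro: less_le_trans[OF exp_gt_zero])
  then have "1 \<le> sqrt (ln ?L)" by simp
  moreover have "1 \<le> sqrt (real (min d M))" using M d by simp
  ultimately have "1 * (2 * 1) \<le> sqrt (real (min d M)) * (2 * sqrt (ln ?L))"
    by (intro mult_mono) auto
  moreover have "Rmin d M m \<le> Rmax d M m"
    using Rmax_ge_Rmin_le[of 1 M 2 d m] M by (simp add: order_trans)
  ultimately have R: "4 \<le> Rmax d M m" "a \<le> Rmax d M m / 2" using a by auto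
  then have r: "12 \<le> r" by (simp add: r_def)
  have near: "\<bar>inner_d d (vdiff (m i) (m 1)) u\<bar> + a \<le> r / 2" if "i \<in> {1..M}" for i
  proof (cases "i = 1")
    case True
    then show ?thesis using R by (simp add: inner_d_def vdiff_def r_def)
  next
    case False
    then have "norm_d d (vdiff (m i) (m 1)) \<le> Rmax d M m"
      using that M by (intro Rmax_ge_Rmin_le) auto
    then show ?thesis
      using abs_inner_d_le[of d "vdiff (m i) (m 1)" u] u R by (simp add: r_def)
  qed

  define h where "h x = \<bar>inner_d d (vdiff x (m 1)) u\<bar> + a" for x
  define f where "f mu x = w1 d M p mu x * inner_d d (vdiff x (mu 1)) u" for mu x
  define F where "F mu X = (1 / real n) * (\<Sum>j<n. f mu (X j)) - (\<integral>x. f mu x \<partial>?N)" for mu X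
  have gsup_eq: "gsup d M p m a u n = (\<lambda>X. SUP mu\<in>?A. F mu X)"
    by (simp add: gsup_def F_def f_def fun_eq_iff)
  have h0: "0 \<le> h x" for x using a by (simp add: h_def)
  have [measurable]: "h \<in> borel_measurable ?N" unfolding h_def by measurable
  have f_le: "\<bar>f mu x\<bar> \<le> h x" if "mu \<in> ?A" for mu x
    unfolding f_def h_def by (rule abs_weighted_inner_le[OF M(2) p(1) u that])
  have majorant: "\<exists>k. integrable ?N k \<and> (\<integral>x. k x \<partial>?N) \<le> exp (((1 + r) * l)\<^sup>2 / 2)
      \<and> (\<forall>x. 0 \<le> k x) \<and> (\<forall>x y. cosh (l * h x + l * h y) \<le> k x * k y)" if "0 \<le> l" for l
    unfolding h_def by (rule GMM_cosh_majorant[OF u p near a(1) r that])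
  \<comment> \<open>Read off from the one-coordinate lemma at \<open>l = 1\<close>, with
    \<open>h\<close> itself as the oscillating function.\<close>
  have int_h: "integrable ?N h"
  proof -
    obtain k where k: "integrable ?N k" "(\<integral>x. k x \<partial>?N) \<le> exp (((1 + r) * 1)\<^sup>2 / 2)"
      "\<And>x. 0 \<le> k x" "\<And>x y. cosh (1 * h x + 1 * h y) \<le> k x * k y"
      using majorant[OF zero_le_one] by blast
    show ?thesis
    proof (rule exp_moment_of_bounded_oscillation(1)[OF N.prob_space_axioms _ _ h0 k(1-3)])
      show "cosh (h x + h y) \<le> k x * k y" for x y using k(4)[of x y] by simp
      show "\<bar>h x - h y\<bar> \<le> h x + h y" for x y using h0[of x] h0[of y] by linarith
    qed measurable
  qed
  have ne: "?A \<noteq> {}"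
  proof -
    have "restrict m {1..M} \<in> ?A"
      using m a by (auto simp: regionA_def norm_d_def inner_d_def vdiff_def)
    then show ?thesis by blast
  qed
  \<comment> \<open>A real supremum is meaningful only for bounded sets. The bound is needed at
    every \<open>X\<close>, not just on the sample space, because measurability is proved on the
    whole topological space.\<close>
  have bdd: "bdd_above ((\<lambda>mu. F mu X) ` ?A)" for X
  proof (rule bdd_aboveI2)
    fix mu assume mu: "mu \<in> ?A"
    have "\<bar>\<integral>x. f mu x \<partial>?N\<bar> \<le> (\<integral>x. \<bar>f mu x\<bar> \<partial>?N)" by (rule integral_abs_bound)
    also have "\<dots> \<le> (\<integral>x. h x \<partial>?N)" by (rule integral_mono'[OF int_h f_le[OF mu] h0])
    finally have "- (\<integral>x. f mu x \<partial>?N) \<le> (\<integral>x. h x \<partial>?N)" by linarith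
    moreover have "(\<Sum>j<n. f mu (X j)) \<le> (\<Sum>j<n. h (X j))"
      using f_le[OF mu] by (intro sum_mono) (simp add: abs_le_iff)
    then have "(1 / real n) * (\<Sum>j<n. f mu (X j)) \<le> (1 / real n) * (\<Sum>j<n. h (X j))"
      by (intro mult_left_mono) auto
    ultimately show "F mu X \<le> (1 / real n) * (\<Sum>j<n. h (X j)) + (\<integral>x. h x \<partial>?N)"
      unfolding F_def by linarith
  qed
  have cont: "continuous_on UNIV (F mu)" for mu
  proof -
    have "continuous_on UNIV (\<lambda>X. f mu (X j))" for j :: nat
      using continuous_on_compose2[OF continuous_on_weighted_inner[OF M(2) p(1)]
          continuous_on_product_coordinates[of j]] by (simp add: f_def)
    then show ?thesis unfolding F_def by (intro continuous_intros)
  qed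
  have g_meas: "gsup d M p m a u n \<in> borel_measurable ?P"
    unfolding gsup_eq
    using measurable_compose[OF measurable_sample_borel measurable_SUP_continuous[OF ne bdd cont]] .
  have osc: "\<bar>gsup d M p m a u n X - gsup d M p m a u n (X(j := y))\<bar> \<le> (h (X j) + h y) / real n"
    if "j < n" for X j y
    unfolding gsup_eq
  proof (rule abs_SUP_diff_le[OF ne bdd bdd])
    fix mu assume mu: "mu \<in> ?A"
    \<comment> \<open>The expectation term of \<open>F\<close> does not depend on the sample and
      cancels, leaving one summand.\<close>
    have "(\<Sum>i<n. f mu (X i)) - (\<Sum>i<n. f mu ((X(j := y)) i)) = f mu (X j) - f mu y"
      using that by (simp add: sum.remove[of "{..<n}" j])
    then have "F mu X - F mu (X(j := y)) = (f mu (X j) - f mu y) / real n"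
      unfolding F_def by (simp add: field_simps flip: diff_divide_distrib)
    also have "\<bar>\<dots>\<bar> \<le> (h (X j) + h y) / real n"
      using f_le[OF mu, of "X j"] f_le[OF mu, of y]
      by (auto simp: abs_divide intro!: divide_right_mono)
    finally show "\<bar>F mu X - F mu (X(j := y))\<bar> \<le> (h (X j) + h y) / real n" .
  qed

  define e where "e = (\<integral>Y. gsup d M p m a u n Y \<partial>?P)"
  define t where "t = 2 * (1 + r) * sqrt (real d * ln (real n) / real n)"
  have "measure ?P {X \<in> space ?P. gsup d M p m a u n X - e > t} \<le> 1 / real n ^ d"
  \<comment> \<open>For a single observation \<open>ln n = 0\<close>, so the scale \<open>l\<close>
    below would vanish; the claimed bound is then 1 and trivial.\<close>
  proof (cases "n = 1")
    case True
    then have "1 / real n ^ d = 1" by simp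
    then show ?thesis using P.prob_le_1 by (simp only:)
  next
    case False
    define q where "q = real d * ln (real n)"
    have q: "0 < q" using False n d by (simp add: q_def)
    \<comment> \<open>The minimiser of the Chernoff exponent
      \<open>n * ((1 + r) * l)\<^sup>2 - n * l * t\<close>: the first term becomes \<open>q\<close>
      and the second \<open>2 * q\<close>, leaving \<open>- q\<close>.\<close>
    define l where "l = sqrt (q / real n) / (1 + r)"
    have l: "0 < l" using q r n by (simp add: l_def)
    have V: "((1 + r) * l)\<^sup>2 = q / real n" using q r n by (simp add: l_def)
    have T: "real n * l * t = 2 * q"
    proof -
      have "real n * l * t = 2 * real n * (sqrt (q / real n))\<^sup>2"
        using r by (simp add: l_def t_def q_def power2_eq_square field_simps)
      then show ?thesis using q n by simp
    qed
    obtain k where k: "integrable ?N k" "(\<integral>x. k x \<partial>?N) \<le> exp (((1 + r) * l)\<^sup>2 / 2)"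
      "\<And>x. 0 \<le> k x" "\<And>x y. cosh (l * h x + l * h y) \<le> k x * k y"
      using majorant[OF less_imp_le[OF l]] by blast
    \<comment> \<open>Scaling by \<open>n * l > 0\<close> turns the oscillation
      \<open>(h (X j) + h y) / n\<close> into \<open>l * h (X j) + l * h y\<close>, the form bounded
      by the majorant.\<close>
    have "{X \<in> space ?P. gsup d M p m a u n X - e > t}
        = {X \<in> space ?P. real n * l * gsup d M p m a u n X
            - (\<integral>Y. real n * l * gsup d M p m a u n Y \<partial>?P) > 2 * q}"
    proof -
      have "t < z - e \<longleftrightarrow> 2 * q < real n * l * z - real n * l * e" for z
        using l n unfolding T[symmetric] by (simp flip: right_diff_distrib)
      then show ?thesis by (simp add: e_def)
    qed
    also have "measure ?P \<dots> \<le> exp (real n * ((1 + r) * l)\<^sup>2 - 2 * q)"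
      unfolding sample_def
    proof (rule mcdiarmid_unbounded[OF N.prob_space_axioms _ _ k])
      show "(\<lambda>X. real n * l * gsup d M p m a u n X) \<in> borel_measurable (PiM {..<n} (\<lambda>_. ?N))"
        using g_meas unfolding sample_def by measurable
      show "0 \<le> l * h x" for x using l h0 by simp
      fix X j y assume "j < n"
      from osc[OF this, of X y]
      have "real n * l * \<bar>gsup d M p m a u n X - gsup d M p m a u n (X(j := y))\<bar>
          \<le> real n * l * ((h (X j) + h y) / real n)"
        using l by (intro mult_left_mono) auto
      also have "\<dots> = l * h (X j) + l * h y" using n by (simp add: field_simps)
      finally show "\<bar>real n * l * gsup d M p m a u n X - real n * l * gsup d M p m a u n (X(j := y))\<bar>
          \<le> l * h (X j) + l * h y"
        using l by (simp add: abs_mult flip: right_diff_distrib)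
    qed measurable
    also have "real n * ((1 + r) * l)\<^sup>2 - 2 * q = - q" unfolding V using n by simp
    also have "exp (- q) = 1 / real n ^ d"
      using n by (simp add: q_def exp_minus exp_of_nat_mult inverse_eq_divide)
    finally show ?thesis .
  qed
  then show "measure ?P {Xs \<in> space ?P.
      gsup d M p m a u n Xs - (\<integral>Ys. gsup d M p m a u n Ys \<partial>?P)
        > 2 * (1 + 3 * Rmax d M m) * sqrt (real d * ln (real n) / real n)} \<le> 1 / real n ^ d"
    by (simp only: e_def t_def r_def)
qed simp

end
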